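(* Consider a run of the IBCN method (described in the context) on a function $f:\mathbb R^n\to\mathbb R$ whose Hessian is Lipschitz continuous with constant $L>0$. Assume there exist finite constants $f^{\min}$ and $B$ such that $f(x)\ge f^{\min}$ and $\|\nabla^2 f(x)\|\le B$ for all $x$ in the level set $\mathcal L^0=\{x\in\mathbb R^n: f(x)\le f(x_0)\}$. Given $\epsilon>0$, let $$K^{\mathrm b}_\epsilon=\{k\ge 0 \text{ an iteration} : \|\nabla_{\mathcal I_k} f(x_{k+1})\|\ge\epsilon\}.$$ Then $$|K^{\mathrm b}_\epsilon\cap\mathcal S|\le\Bigl(\frac{f(x_0)-f^{\min}}{c_2}\Bigr)\epsilon^{-3/2},\qquad\text{where } c_2=\frac{\eta_1\sigma^{\min}}{6}\Bigl(\tau+\frac{\sigma^{\max}+L}{2}\Bigr)^{-3/2}$$ and $\sigma^{\max}=\max\{\sigma_0,\ \gamma_3L/(1-\eta_2)\}$. Moreover, let $\bar k$ be the first iteration such that $\bar k\notin K^{\mathrm b}_\epsilon$ (that is, the smallest nonnegative integer not in $K^{\mathrm b}_\epsilon$). Then $$\bar k\le\Bigl(1+\frac{|\log\gamma_1|}{\log\gamma_2}\Bigr)\Bigl(\frac{f(x_0)-f^{\min}}{c_2}\Bigr)\epsilon^{-3/2}+\frac{1}{\log\gamma_2}\log\Bigl(\frac{\sigma^{\max}}{\sigma_0}\Bigr).$$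
   Context: Setting and notation. $f:\mathbb R^n\to\mathbb R$ is a (possibly non-convex) twice differentiable function with $\|\nabla^2 f(x)-\nabla^2 f(y)\|\le L\|x-y\|$ for all $x,y\in\mathbb R^n$, where $L>0$. $\|\cdot\|$ is the Euclidean norm for vectors and the induced operator norm for matrices. For $\mathcal I\subseteq\{1,\dots,n\}$, $U_{\mathcal I}\in\mathbb R^{n\times|\mathcal I|}$ is the submatrix of the $n\times n$ identity obtained by keeping the columns with indices in $\mathcal I$; $\nabla_{\mathcal I}f(x)=U_{\mathcal I}^T\nabla f(x)$ and $\nabla^2_{\mathcal I}f(x)=U_{\mathcal I}^T\nabla^2 f(x)U_{\mathcal I}$. IBCN method. Parameters: $x_0\in\mathbb R^n$, $\sigma^{\min}>0$, $\sigma_0\in[\sigma^{\min},\infty)$, $0<\eta_1\le\eta_2<1$, $0<\gamma_1\le1<\gamma_2\le\gamma_3$, $\tau\in[0,\infty)$, $\beta\in(0,1)$, $\theta\in(0,1]$. For $k=0,1,2,\dots$: if $\nabla f(x_k)=0$, stop; otherwise perform iteration $k$: (1) choose any block $\mathcal I_k\subseteq\{1,\dots,n\}$ with $\|\nabla_{\mathcal I_k}f(x_k)\|\ge\theta\|\nabla f(x_k)\|$; (2) define, for $s\in\mathbb R^{|\mathcal I_k|}$, $q_k(s)=f(x_k)+\nabla_{\mathcal I_k}f(x_k)^Ts+\frac12 s^T\nabla^2_{\mathcal I_k}f(x_k)s$ and $m_k(s)=q_k(s)+\frac{\sigma_k}{6}\|s\|^3$, and choose any $s_k\in\mathbb R^{|\mathcal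 I_k|}$ with $\|\nabla m_k(s_k)\|\le\tau\|s_k\|^2$ and $m_k(s_k)\le m_k(\hat s_k)$, where $\hat s_k=-\hat\alpha_k\nabla_{\mathcal I_k}f(x_k)$ and $\hat\alpha_k=\min\Bigl\{\frac{\beta}{\|\nabla^2_{\mathcal I_k}f(x_k)\|},\sqrt{\frac{3\beta}{\sigma_k\|\nabla_{\mathcal I_k}f(x_k)\|}}\Bigr\}$ (the first argument of the min is $+\infty$ when $\|\nabla^2_{\mathcal I_k}f(x_k)\|=0$); (3) compute $\rho_k=\frac{f(x_k)-f(x_k+U_{\mathcal I_k}s_k)}{q_k(0)-q_k(s_k)}$; (4) set $x_{k+1}=x_k+U_{\mathcal I_k}s_k$ if $\rho_k\ge\eta_1$, and $x_{k+1}=x_k$ otherwise; (5) choose any $\sigma_{k+1}\in[\max\{\sigma^{\min},\gamma_1\sigma_k\},\sigma_k]$ if $\rho_k\ge\eta_2$; any $\sigma_{k+1}\in[\sigma_k,\gamma_2\sigma_k]$ if $\rho_k\in[\eta_1,\eta_2)$; any $\sigma_{k+1}\in[\gamma_2\sigma_k,\gamma_3\sigma_k]$ if $\rho_k<\eta_1$. "Iteration" means an iteration that is actually performed (all $k\ge0$ if the method never stops). $\mathcal S=\{k:\rho_k\ge\eta_1\}$ is the set of successful iterations. *)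

theory Defs
  imports "HOL-Analysis.Analysis"
begin

definition gradient :: "('a::real_inner \<Rightarrow> real) \<Rightarrow> 'a \<Rightarrow> 'a" where
  "gradient f x = (THE g. GDERIV f x :> g)"

definition hessian :: "(real ^ 'n \<Rightarrow> real) \<Rightarrow> real ^ 'n \<Rightarrow> real ^ 'n ^ 'n" where
  "hessian f x = jacobian (gradient f) (at x)"

definition op_norm :: "real ^ 'n ^ 'm \<Rightarrow> real" where
  "op_norm A = onorm (\<lambda>v. A *v v)"

text \<open>
  Blocks. The index set of \<open>real ^ 'n\<close> is the type \<open>'n\<close>, and a block is a set \<open>I\<close> of indices.
  The space of vectors indexed by \<open>I\<close> (of dimension \<open>card I\<close>) is identified with the
  coordinate subspace \<open>block_space I\<close>, by means of the isometry \<open>U\<^sub>I\<close> (the columns of the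
  identity matrix with indices in \<open>I\<close>). So \<open>U\<^sub>I s\<close> is written \<open>s\<close>, the vector \<open>U\<^sub>I\<^sup>T v\<close> is
  \<open>block_vec I v\<close>, and the matrix \<open>U\<^sub>I\<^sup>T A U\<^sub>I\<close> is \<open>block_mat I A\<close>, the principal submatrix
  padded with zeros. Inner products, Euclidean norms and operator norms are the same as for
  the vectors and matrices of size \<open>card I\<close>.
\<close>

definition block_space :: "'n set \<Rightarrow> (real ^ 'n) set" where
  "block_space I = {s. \<forall>i. i \<notin> I \<longrightarrow> s $ i = 0}"

definition block_vec :: "'n set \<Rightarrow> real ^ 'n \<Rightarrow> real ^ 'n" where
  "block_vec I v = (\<chi> i. if i \<in> I then v $ i else 0)"

definition block_mat :: "'n set \<Rightarrow> real ^ 'n ^ 'n \<Rightarrow> real ^ 'n ^ 'n" where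
  "block_mat I A = (\<chi> i j. if i \<in> I \<and> j \<in> I then A $ i $ j else 0)"

definition block_gradient :: "(real ^ 'n \<Rightarrow> real) \<Rightarrow> 'n set \<Rightarrow> real ^ 'n \<Rightarrow> real ^ 'n" where
  "block_gradient f I x = block_vec I (gradient f x)"

definition block_hessian :: "(real ^ 'n \<Rightarrow> real) \<Rightarrow> 'n set \<Rightarrow> real ^ 'n \<Rightarrow> real ^ 'n ^ 'n" where
  "block_hessian f I x = block_mat I (hessian f x)"

text \<open>
  The models are defined on all of \<open>real ^ 'n\<close> by the same formulas. At a point of
  \<open>block_space I\<close> the gradient of the cubic model lies in \<open>block_space I\<close>, and it is the gradient
  of the model as a function on \<open>block_space I\<close>.
\<close>

definition quad_model :: "(real ^ 'n \<Rightarrow> real) \<Rightarrow> real ^ 'n \<Rightarrow> 'n set \<Rightarrow> real ^ 'n \<Rightarrow> real" where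
  "quad_model f x I s =
     f x + block_gradient f I x \<bullet> s + 1 / 2 * (s \<bullet> (block_hessian f I x *v s))"

definition cubic_model ::
    "(real ^ 'n \<Rightarrow> real) \<Rightarrow> real ^ 'n \<Rightarrow> 'n set \<Rightarrow> real \<Rightarrow> real ^ 'n \<Rightarrow> real" where
  "cubic_model f x I \<sigma> s = quad_model f x I s + \<sigma> / 6 * norm s ^ 3"

definition cauchy_stepsize ::
    "(real ^ 'n \<Rightarrow> real) \<Rightarrow> real \<Rightarrow> real ^ 'n \<Rightarrow> 'n set \<Rightarrow> real \<Rightarrow> real" where
  "cauchy_stepsize f \<beta> x I \<sigma> =
     (let a = sqrt (3 * \<beta> / (\<sigma> * norm (block_gradient f I x)));
          h = op_norm (block_hessian f I x)
      in if h = 0 then a else min (\<beta> / h) a)"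

definition cauchy_step ::
    "(real ^ 'n \<Rightarrow> real) \<Rightarrow> real \<Rightarrow> real ^ 'n \<Rightarrow> 'n set \<Rightarrow> real \<Rightarrow> real ^ 'n" where
  "cauchy_step f \<beta> x I \<sigma> = - (cauchy_stepsize f \<beta> x I \<sigma> *\<^sub>R block_gradient f I x)"

definition reduction_ratio ::
    "(real ^ 'n \<Rightarrow> real) \<Rightarrow> real ^ 'n \<Rightarrow> 'n set \<Rightarrow> real ^ 'n \<Rightarrow> real" where
  "reduction_ratio f x I s =
     (f x - f (x + s)) / (quad_model f x I 0 - quad_model f x I s)"

text \<open>
  A run is given by total sequences \<open>x\<close>, \<open>I\<close>, \<open>s\<close>, \<open>\<sigma>\<close> of iterates, blocks, steps and
  regularization parameters. If the method stops, their later entries are unconstrained;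
  \<open>performed f x k\<close> says that the method has not stopped at any of the iterates
  \<open>x 0, \<dots>, x k\<close>, so that iteration \<open>k\<close> takes place.
\<close>

definition performed :: "(real ^ 'n \<Rightarrow> real) \<Rightarrow> (nat \<Rightarrow> real ^ 'n) \<Rightarrow> nat \<Rightarrow> bool" where
  "performed f x k \<longleftrightarrow> (\<forall>j\<le>k. gradient f (x j) \<noteq> 0)"

definition ibcn_iteration ::
    "(real ^ 'n \<Rightarrow> real) \<Rightarrow> real \<Rightarrow> real \<Rightarrow> real \<Rightarrow> real \<Rightarrow> real \<Rightarrow> real \<Rightarrow> real \<Rightarrow> real \<Rightarrow> real \<Rightarrow>
     real ^ 'n \<Rightarrow> 'n set \<Rightarrow> real ^ 'n \<Rightarrow> real \<Rightarrow> real ^ 'n \<Rightarrow> real \<Rightarrow> bool" where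
  "ibcn_iteration f \<sigma>min \<eta>1 \<eta>2 \<gamma>1 \<gamma>2 \<gamma>3 \<tau> \<beta> \<theta> x I s \<sigma> x' \<sigma>' \<longleftrightarrow>
     norm (block_gradient f I x) \<ge> \<theta> * norm (gradient f x) \<and>
     s \<in> block_space I \<and>
     norm (gradient (cubic_model f x I \<sigma>) s) \<le> \<tau> * (norm s)\<^sup>2 \<and>
     cubic_model f x I \<sigma> s \<le> cubic_model f x I \<sigma> (cauchy_step f \<beta> x I \<sigma>) \<and>
     (let \<rho> = reduction_ratio f x I s in
        x' = (if \<rho> \<ge> \<eta>1 then x + s else x) \<and>
        (if \<rho> \<ge> \<eta>2 then \<sigma>' \<in> {max \<sigma>min (\<gamma>1 * \<sigma>)..\<sigma>}
         else if \<rho> \<ge> \<eta>1 then \<sigma>' \<in> {\<sigma>..\<gamma>2 * \<sigma>}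
         else \<sigma>' \<in> {\<gamma>2 * \<sigma>..\<gamma>3 * \<sigma>}))"

definition ibcn_run ::
    "(real ^ 'n \<Rightarrow> real) \<Rightarrow> real \<Rightarrow> real \<Rightarrow> real \<Rightarrow> real \<Rightarrow> real \<Rightarrow> real \<Rightarrow> real \<Rightarrow> real \<Rightarrow> real \<Rightarrow>
     (nat \<Rightarrow> real ^ 'n) \<Rightarrow> (nat \<Rightarrow> 'n set) \<Rightarrow> (nat \<Rightarrow> real ^ 'n) \<Rightarrow> (nat \<Rightarrow> real) \<Rightarrow> bool" where
  "ibcn_run f \<sigma>min \<eta>1 \<eta>2 \<gamma>1 \<gamma>2 \<gamma>3 \<tau> \<beta> \<theta> x I s \<sigma> \<longleftrightarrow>
     (\<forall>k. performed f x k \<longrightarrow>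
        ibcn_iteration f \<sigma>min \<eta>1 \<eta>2 \<gamma>1 \<gamma>2 \<gamma>3 \<tau> \<beta> \<theta>
          (x k) (I k) (s k) (\<sigma> k) (x (Suc k)) (\<sigma> (Suc k)))"

definition successful ::
    "(real ^ 'n \<Rightarrow> real) \<Rightarrow> real \<Rightarrow> (nat \<Rightarrow> real ^ 'n) \<Rightarrow> (nat \<Rightarrow> 'n set) \<Rightarrow> (nat \<Rightarrow> real ^ 'n) \<Rightarrow>
     nat set" where
  "successful f \<eta>1 x I s = {k. performed f x k \<and> reduction_ratio f (x k) (I k) (s k) \<ge> \<eta>1}"

definition large_block_gradient ::
    "(real ^ 'n \<Rightarrow> real) \<Rightarrow> (nat \<Rightarrow> real ^ 'n) \<Rightarrow> (nat \<Rightarrow> 'n set) \<Rightarrow> real \<Rightarrow> nat set" where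
  "large_block_gradient f x I \<epsilon> =
     {k. performed f x k \<and> norm (block_gradient f (I k) (x (Suc k))) \<ge> \<epsilon>}"

end

theory Submission
  imports Defs
begin

text \<open>
  The Cauchy step strictly decreases the cubic model, so every trial step \<open>s\<close> satisfies
  \<open>m(s) < f(x)\<close>. This alone gives the quadratic decrease
  \<open>q(0) - q(s) > \<sigma>/6 * \<parallel>s\<parallel>\<^sup>3\<close>, the quantity against which everything is measured
  (\<open>cubic_model_cauchy_step_less\<close>, \<open>quad_model_decrease\<close>).

  Since the Hessian is Lipschitz continuous, \<open>f(x + s)\<close> and \<open>q(s)\<close> differ by at most
  \<open>L/6 * \<parallel>s\<parallel>\<^sup>3\<close> (\<open>taylor\<close>). Comparing the two cubic terms, \<open>\<rho> \<ge> 1 - L/\<sigma>\<close>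
  (\<open>reduction_ratio_ge\<close>). Hence \<open>\<sigma>\<close> can grow only while it is at most \<open>L/(1 - \<eta>\<^sub>2)\<close>, and it never
  exceeds \<open>\<sigma>max\<close> (\<open>regularization_bounds\<close>).

  The first-order expansion of the gradient (\<open>gradient_taylor\<close>), together with the accuracy
  condition \<open>\<parallel>\<nabla>m(s)\<parallel> \<le> \<tau> * \<parallel>s\<parallel>\<^sup>2\<close>, bounds the block gradient at \<open>x + s\<close> by
  \<open>(\<tau> + (\<sigma> + L)/2) * \<parallel>s\<parallel>\<^sup>2\<close> (\<open>block_gradient_after_step_le\<close>). If a successful iteration
  leaves this gradient at least \<open>\<epsilon>\<close>, then the step has length of order \<open>\<epsilon>\<close> to the power \<open>1/2\<close>,
  and \<open>f\<close> drops by at least \<open>c2\<close> times \<open>\<epsilon>\<close> to the power \<open>3/2\<close> (\<open>large_gradient_decrease\<close>). As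
  \<open>f\<close> never increases and stays above \<open>fmin\<close>, there are boundedly many such iterations.

  Finally, an unsuccessful iteration multiplies \<open>\<sigma>\<close> by at least \<open>\<gamma>\<^sub>2 > 1\<close> and a successful one by
  at least \<open>\<gamma>\<^sub>1\<close>. As \<open>\<sigma>\<close> stays below \<open>\<sigma>max\<close>, the number of unsuccessful iterations is controlled
  by the number of successful ones (\<open>iterations_le_of_growth\<close>); before the first index outside
  the set of iterations with large block gradient, all the successful ones are covered by the
  first count.
\<close>

section \<open>Taylor bounds for a Lipschitz continuous Hessian\<close>

text \<open>
  Both Taylor estimates integrate, along the segment from \<open>x\<close> to \<open>x + s\<close>, a derivative that
  grows like a power of the parameter. The mean value inequality with the comparison function
  \<open>c * t ^ (m + 1) / (m + 1)\<close> plays the part of the integral.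
\<close>

lemma norm_le_of_derivative_le_power:
  fixes \<phi> :: "real \<Rightarrow> 'a::real_normed_vector"
  assumes deriv: "\<And>t. (\<phi> has_vector_derivative \<phi>' t) (at t)"
    and bound: "\<And>t. 0 < t \<Longrightarrow> t < 1 \<Longrightarrow> norm (\<phi>' t) \<le> c * t ^ m"
    and "\<phi> 0 = 0"
  shows "norm (\<phi> 1) \<le> c / real (Suc m)"
proof -
  have cont: "continuous_on {0..1} \<phi>"
    by (meson deriv has_vector_derivative_continuous continuous_at_imp_continuous_on)
  have deriv_power: "((\<lambda>t. c / real (Suc m) * t ^ Suc m) has_vector_derivative c * t ^ m) (at t)"
    for t :: real
    unfolding has_real_derivative_iff_has_vector_derivative[symmetric]
    by (rule derivative_eq_intros refl | simp)+
  have "norm (\<phi> 1 - \<phi> 0) \<le> c / real (Suc m) * 1 ^ Suc m - c / real (Suc m) * 0 ^ Suc m"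
    by (rule differentiable_bound_general[OF zero_less_one cont _ deriv deriv_power bound])
      (auto intro!: continuous_intros)
  then show ?thesis
    using \<open>\<phi> 0 = 0\<close> by simp
qed

lemma norm_matrix_vector_le: "norm (A *v v) \<le> op_norm A * norm v"
  unfolding op_norm_def by (rule onorm) (rule matrix_vector_mul_bounded_linear)

lemma abs_quadratic_form_le: "\<bar>v \<bullet> (A *v v)\<bar> \<le> op_norm A * (norm v)\<^sup>2"
proof -
  have "\<bar>v \<bullet> (A *v v)\<bar> \<le> norm v * norm (A *v v)"
    by (rule Cauchy_Schwarz_ineq2)
  also have "\<dots> \<le> norm v * (op_norm A * norm v)"
    by (intro mult_left_mono norm_matrix_vector_le norm_ge_zero)
  finally show ?thesis
    by (simp add: power2_eq_square mult_ac)
qed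

lemma gradient_eqI:
  assumes "GDERIV f x :> g"
  shows "gradient f x = g"
  unfolding gradient_def
proof (rule the_equality[where P="\<lambda>g. GDERIV f x :> g", OF assms])
  fix g' assume "GDERIV f x :> g'"
  then have "(\<lambda>h. h \<bullet> g') = (\<lambda>h. h \<bullet> g)"
    using assms unfolding gderiv_def by (rule has_derivative_unique)
  then have "(g' - g) \<bullet> g' = (g' - g) \<bullet> g"
    by (rule fun_cong)
  then have "(g' - g) \<bullet> (g' - g) = 0"
    by (simp add: inner_diff_right)
  then show "g' = g"
    by simp
qed

lemma gderiv_gradient:
  fixes f :: "real ^ 'n \<Rightarrow> real"
  assumes "f differentiable (at x)"
  shows "GDERIV f x :> gradient f x"
proof -
  obtain f' where f': "(f has_derivative f') (at x)"
    using assms unfolding differentiable_def by blast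
  have "f' h = h \<bullet> adjoint f' 1" for h
    using adjoint_works[OF has_derivative_linear[OF f'], of h 1] by simp
  then have "GDERIV f x :> adjoint f' 1"
    using f' unfolding gderiv_def by (metis (no_types, lifting) ext)
  with gradient_eqI[OF this] show ?thesis
    by simp
qed

locale lipschitz_hessian =
  fixes f :: "real ^ 'n \<Rightarrow> real" and L :: real
  assumes differentiable: "f differentiable (at y)"
    and gradient_differentiable: "gradient f differentiable (at y)"
    and lipschitz: "op_norm (hessian f y - hessian f z) \<le> L * norm (y - z)"
    and L_pos: "0 < L"
begin

lemma has_derivative_gradient: "(gradient f has_derivative (\<lambda>h. hessian f y *v h)) (at y)"
  using gradient_differentiable jacobian_works unfolding hessian_def by blast

lemma norm_hessian_diff_le:
  "norm (hessian f y *v v - hessian f z *v v) \<le> L * norm (y - z) * norm v"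
  using norm_matrix_vector_le[of "hessian f y - hessian f z" v]
    mult_right_mono[OF lipschitz norm_ge_zero, of y z v]
  by (simp add: matrix_vector_mult_diff_rdistrib)

text \<open>
  The derivative of the remainder along the segment is \<open>(\<nabla>\<^sup>2f(x + ts) - \<nabla>\<^sup>2f(x)) s\<close>, of norm at
  most \<open>L * t * \<parallel>s\<parallel>\<^sup>2\<close>; integrating \<open>t\<close> gives the factor \<open>1/2\<close>.
\<close>

lemma gradient_taylor:
  "norm (gradient f (x + s) - gradient f x - hessian f x *v s) \<le> L / 2 * (norm s)\<^sup>2"
proof -
  let ?\<phi> = "\<lambda>t. gradient f (x + t *\<^sub>R s) - gradient f x - t *\<^sub>R (hessian f x *v s)"
  let ?\<phi>' = "\<lambda>t. hessian f (x + t *\<^sub>R s) *v s - hessian f x *v s"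
  have "norm (?\<phi> 1) \<le> L * (norm s)\<^sup>2 / real (Suc 1)"
  proof (rule norm_le_of_derivative_le_power[where \<phi>="?\<phi>" and \<phi>'="?\<phi>'"])
    fix t :: real
    have "((gradient f \<circ> (\<lambda>t. x + t *\<^sub>R s)) has_derivative
        ((\<lambda>h. hessian f (x + t *\<^sub>R s) *v h) \<circ> (\<lambda>h. h *\<^sub>R s))) (at t)"
      by (rule diff_chain_at) (auto intro!: derivative_eq_intros has_derivative_gradient)
    then have "((\<lambda>t. gradient f (x + t *\<^sub>R s)) has_vector_derivative
        hessian f (x + t *\<^sub>R s) *v s) (at t)"
      by (simp add: has_vector_derivative_def o_def matrix_vector_mult_scaleR)
    then show "(?\<phi> has_vector_derivative ?\<phi>' t) (at t)"
      by (auto intro!: derivative_eq_intros)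
    assume "0 < t" "t < 1"
    then show "norm (?\<phi>' t) \<le> L * (norm s)\<^sup>2 * t ^ 1"
      using norm_hessian_diff_le[of "x + t *\<^sub>R s" s x] by (simp add: power2_eq_square mult_ac)
  qed simp
  then show ?thesis
    by simp
qed

text \<open>
  The derivative of the remainder along the segment is the inner product of \<open>s\<close> with the remainder
  of the previous lemma for \<open>ts\<close>, so it is at most \<open>L/2 * t\<^sup>2 * \<parallel>s\<parallel>\<^sup>3\<close>.
\<close>

lemma taylor:
  "\<bar>f (x + s) - f x - gradient f x \<bullet> s - 1 / 2 * (s \<bullet> (hessian f x *v s))\<bar>
     \<le> L / 6 * norm s ^ 3"
proof -
  let ?\<phi> = "\<lambda>t. f (x + t *\<^sub>R s) - f x - t * (gradient f x \<bullet> s)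
    - t\<^sup>2 * (1 / 2 * (s \<bullet> (hessian f x *v s)))"
  let ?\<phi>' = "\<lambda>t. s \<bullet> (gradient f (x + t *\<^sub>R s) - gradient f x - hessian f x *v (t *\<^sub>R s))"
  have "norm (?\<phi> 1) \<le> L / 2 * norm s ^ 3 / real (Suc 2)"
  proof (rule norm_le_of_derivative_le_power[where \<phi>="?\<phi>" and \<phi>'="?\<phi>'"])
    fix t :: real
    have "((f \<circ> (\<lambda>t. x + t *\<^sub>R s)) has_derivative
        ((\<lambda>h. h \<bullet> gradient f (x + t *\<^sub>R s)) \<circ> (\<lambda>h. h *\<^sub>R s))) (at t)"
      using gderiv_gradient[OF differentiable] unfolding gderiv_def
      by (intro diff_chain_at) (auto intro!: derivative_eq_intros)
    then have "((\<lambda>t. f (x + t *\<^sub>R s)) has_real_derivative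
        s \<bullet> gradient f (x + t *\<^sub>R s)) (at t)"
      by (simp add: has_field_derivative_def o_def mult_commute_abs)
    then have "(?\<phi> has_real_derivative ?\<phi>' t) (at t)"
      by (auto intro!: derivative_eq_intros
          simp: inner_diff_right matrix_vector_mult_scaleR inner_commute)
    then show "(?\<phi> has_vector_derivative ?\<phi>' t) (at t)"
      by (simp add: has_real_derivative_iff_has_vector_derivative)
    assume "0 < t" "t < 1"
    have "norm (?\<phi>' t) \<le> norm s * (L / 2 * (norm (t *\<^sub>R s))\<^sup>2)"
      by (rule order_trans[OF Cauchy_Schwarz_ineq2[folded real_norm_def]])
        (intro mult_left_mono gradient_taylor norm_ge_zero)
    also have "\<dots> = L / 2 * norm s ^ 3 * t ^ 2"
      by (simp add: power2_eq_square power3_eq_cube mult_ac)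
    finally show "norm (?\<phi>' t) \<le> L / 2 * norm s ^ 3 * t ^ 2" .
  qed simp
  then show ?thesis
    by simp
qed

text \<open>
  Expand \<open>f(x + v + w)\<close> to second order in two ways: around \<open>x\<close> with increment \<open>v + w\<close>, and
  around \<open>x + v\<close> with increment \<open>w\<close>. Only the second expansion distinguishes \<open>v\<close> from \<open>w\<close>, and the
  two agree up to terms of third order.
\<close>

lemma hessian_asymmetry_le:
  "\<bar>w \<bullet> (hessian f x *v v) - v \<bullet> (hessian f x *v w)\<bar> \<le> 3 * L * (norm v + norm w) ^ 3"
proof -
  define n where "n = norm v + norm w"
  let ?R = "\<lambda>x s. f (x + s) - f x - gradient f x \<bullet> s - 1 / 2 * (s \<bullet> (hessian f x *v s))"
  let ?G = "w \<bullet> (gradient f (x + v) - gradient f x - hessian f x *v v)"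
  let ?Q = "w \<bullet> (hessian f (x + v) *v w - hessian f x *v w)"
  have n: "norm v \<le> n" "norm w \<le> n" "norm (v + w) \<le> n" "0 \<le> n"
    unfolding n_def by (auto simp: norm_triangle_ineq)
  have identity: "w \<bullet> (hessian f x *v v) - v \<bullet> (hessian f x *v w)
      = 2 * (?R x (v + w) - ?R x v - ?R (x + v) w - ?G) - ?Q"
    by (simp add: algebra_simps inner_simps matrix_vector_right_distrib inner_commute)
  have remainder: "\<bar>?R y s\<bar> \<le> L / 6 * n ^ 3" if "norm s \<le> n" for y s
    by (rule order_trans[OF taylor]) (use that L_pos in \<open>auto intro!: mult_left_mono power_mono\<close>)
  have "\<bar>?G\<bar> \<le> norm w * (L / 2 * (norm v)\<^sup>2)"
    by (rule order_trans[OF Cauchy_Schwarz_ineq2])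
      (intro mult_left_mono gradient_taylor norm_ge_zero)
  also have "\<dots> \<le> n * (L / 2 * n\<^sup>2)"
    using n L_pos by (intro mult_mono power_mono) auto
  finally have G: "\<bar>?G\<bar> \<le> L / 2 * n ^ 3"
    by (simp add: power2_eq_square power3_eq_cube mult_ac)
  have "\<bar>?Q\<bar> \<le> norm w * (L * norm (x + v - x) * norm w)"
    by (rule order_trans[OF Cauchy_Schwarz_ineq2])
      (intro mult_left_mono norm_hessian_diff_le norm_ge_zero)
  also have "\<dots> \<le> n * (L * n * n)"
    using n L_pos by (intro mult_mono) auto
  finally have Q: "\<bar>?Q\<bar> \<le> L * n ^ 3"
    by (simp add: power3_eq_cube mult_ac)
  have arith: "\<bar>2 * (a - b - c - g) - q\<bar> \<le> 3 * M"
    if "\<bar>a\<bar> \<le> M / 6" "\<bar>b\<bar> \<le> M / 6" "\<bar>c\<bar> \<le> M / 6" "\<bar>g\<bar> \<le> M / 2" "\<bar>q\<bar> \<le> M"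
    for a b c g q M :: real
    using that unfolding abs_le_iff by argo
  have "\<bar>2 * (?R x (v + w) - ?R x v - ?R (x + v) w - ?G) - ?Q\<bar> \<le> 3 * (L * n ^ 3)"
    using remainder[OF n(3)] remainder[OF n(1)] remainder[OF n(2)] G Q
    by (intro arith) simp_all
  then show ?thesis
    unfolding identity n_def by simp
qed

text \<open>
  When \<open>v\<close> and \<open>w\<close> are scaled by \<open>t\<close>, the asymmetry scales with \<open>t\<^sup>2\<close> but its bound with
  \<open>t\<^sup>3\<close>, which forces it to vanish. Symmetry is what makes \<open>H s\<close>, rather than the symmetrized
  \<open>(H + H\<^sup>T) s / 2\<close>, the gradient of the quadratic term of the model.
\<close>

lemma hessian_symmetric: "w \<bullet> (hessian f x *v v) = v \<bullet> (hessian f x *v w)"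
proof -
  define D where "D = w \<bullet> (hessian f x *v v) - v \<bullet> (hessian f x *v w)"
  define C where "C = 3 * L * (norm v + norm w) ^ 3"
  have "\<bar>D\<bar> \<le> 0 + e" if "0 < e" for e :: real
  proof -
    have "0 \<le> C"
      using L_pos by (simp add: C_def)
    \<comment> \<open>Small enough for \<open>C * t \<le> e\<close>; adding 1 covers \<open>C = 0\<close>.\<close>
    define t where "t = e / (C + 1)"
    have "0 < t" "C * t \<le> e"
      using \<open>0 \<le> C\<close> \<open>0 < e\<close> by (auto simp: t_def field_simps)
    have "t\<^sup>2 * D = (t *\<^sub>R w) \<bullet> (hessian f x *v (t *\<^sub>R v)) - (t *\<^sub>R v) \<bullet> (hessian f x *v (t *\<^sub>R w))"
      by (simp add: D_def matrix_vector_mult_scaleR power2_eq_square algebra_simps)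
    then have "\<bar>t\<^sup>2 * D\<bar> \<le> 3 * L * (norm (t *\<^sub>R v) + norm (t *\<^sub>R w)) ^ 3"
      using hessian_asymmetry_le[of "t *\<^sub>R w" x "t *\<^sub>R v"] by simp
    also have "\<dots> = t\<^sup>2 * (C * t)"
      using \<open>0 < t\<close>
      by (simp add: C_def power_mult_distrib distrib_left[symmetric] power2_eq_square power3_eq_cube)
    finally have "\<bar>D\<bar> \<le> C * t"
      using \<open>0 < t\<close> by (simp add: abs_mult)
    then show ?thesis
      using \<open>C * t \<le> e\<close> by simp
  qed
  then have "\<bar>D\<bar> \<le> 0"
    by (rule field_le_epsilon)
  then show ?thesis
    by (simp add: D_def)
qed

end

section \<open>Blocks\<close>

lemma norm_block_vec_le: "norm (block_vec I v) \<le> norm v"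
  by (rule norm_le_componentwise_cart) (simp add: block_vec_def)

lemma inner_block_vec: "block_vec I v \<bullet> w = v \<bullet> block_vec I w"
  by (auto simp: block_vec_def inner_vec_def intro!: sum.cong)

lemma block_vec_diff: "block_vec I (v - w) = block_vec I v - block_vec I w"
  by (simp add: block_vec_def vec_eq_iff)

lemma block_vec_of_block_space: "s \<in> block_space I \<Longrightarrow> block_vec I s = s"
  by (simp add: block_vec_def block_space_def vec_eq_iff)

lemma block_mat_vector_mult: "block_mat I A *v v = block_vec I (A *v block_vec I v)"
  by (auto simp: block_mat_def block_vec_def matrix_vector_mult_def vec_eq_iff intro!: sum.cong)

lemma quad_model_on_block_space:
  assumes "s \<in> block_space I"
  shows "quad_model f x I s = f x + gradient f x \<bullet> s + 1 / 2 * (s \<bullet> (hessian f x *v s))"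
  using assms
  by (simp add: quad_model_def block_gradient_def block_hessian_def block_mat_vector_mult
      inner_block_vec block_vec_of_block_space flip: inner_block_vec[of I s])

lemma quad_model_0: "quad_model f x I 0 = f x"
  by (simp add: quad_model_def)

section \<open>A single iteration\<close>

text \<open>
  For a step \<open>-\<alpha> g\<close> with \<open>n = \<parallel>g\<parallel>\<close> and \<open>h = \<parallel>H\<parallel>\<close>, the model changes by at most
  \<open>- \<alpha> * n\<^sup>2 * (1 - \<alpha> * h / 2 - \<sigma> * n * \<alpha>\<^sup>2 / 6)\<close>. The two arguments of the minimum that defines
  the step size make each of the two subtracted terms at most \<open>\<beta> / 2\<close>.
\<close>

lemma cubic_model_cauchy_step_less:
  assumes "0 < \<sigma>" "0 < \<beta>" "\<beta> < 1" and nonzero: "block_gradient f I x \<noteq> 0"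
  shows "cubic_model f x I \<sigma> (cauchy_step f \<beta> x I \<sigma>) < f x"
proof -
  define g H n h \<alpha> where defs: "g = block_gradient f I x" "H = block_hessian f I x"
    "n = norm g" "h = op_norm H" "\<alpha> = cauchy_stepsize f \<beta> x I \<sigma>"
  have "0 < n"
    using nonzero by (simp add: defs)
  have "0 \<le> h"
    unfolding defs op_norm_def by (rule onorm_pos_le) (rule matrix_vector_mul_bounded_linear)
  \<comment> \<open>The second argument of the minimum that defines \<open>\<alpha>\<close>.\<close>
  define r where "r = sqrt (3 * \<beta> / (\<sigma> * n))"
  have "0 < r" and r2: "r\<^sup>2 = 3 * \<beta> / (\<sigma> * n)"
    using \<open>0 < \<sigma>\<close> \<open>0 < \<beta>\<close> \<open>0 < n\<close> by (simp_all add: r_def)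
  have \<alpha>: "\<alpha> = (if h = 0 then r else min (\<beta> / h) r)"
    unfolding r_def defs cauchy_stepsize_def Let_def ..
  have "0 < \<alpha>" "\<alpha> \<le> r"
    using \<alpha> \<open>0 < r\<close> \<open>0 \<le> h\<close> \<open>0 < \<beta>\<close> by auto
  have \<alpha>h: "\<alpha> * h \<le> \<beta>"
    using \<alpha> \<open>0 \<le> h\<close> \<open>0 < \<beta>\<close> by (auto simp: min_def field_simps)
  have "\<alpha>\<^sup>2 \<le> r\<^sup>2"
    using \<open>0 < \<alpha>\<close> \<open>\<alpha> \<le> r\<close> by (intro power_mono) auto
  then have \<alpha>\<sigma>: "\<sigma> * n * \<alpha>\<^sup>2 \<le> 3 * \<beta>"
    using r2 \<open>0 < \<sigma>\<close> \<open>0 < n\<close> by (simp add: field_simps)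
  have step: "cauchy_step f \<beta> x I \<sigma> = - (\<alpha> *\<^sub>R g)"
    by (simp add: cauchy_step_def defs)
  have "H *v (- (\<alpha> *\<^sub>R g)) = - (\<alpha> *\<^sub>R (H *v g))"
    by (metis matrix_vector_mult_scaleR scaleR_minus_left)
  then have "cubic_model f x I \<sigma> (cauchy_step f \<beta> x I \<sigma>)
      = f x - \<alpha> * n\<^sup>2 + \<alpha>\<^sup>2 / 2 * (g \<bullet> (H *v g)) + \<sigma> / 6 * (\<alpha> * n) ^ 3"
    using \<open>0 < \<alpha>\<close>
    unfolding step cubic_model_def quad_model_def defs(1,2)[symmetric]
    by (simp add: defs(3) power2_eq_square flip: power2_norm_eq_inner)
  also have "\<dots> \<le> f x - \<alpha> * n\<^sup>2 + \<alpha>\<^sup>2 / 2 * (h * n\<^sup>2) + \<sigma> / 6 * (\<alpha> * n) ^ 3"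
    using abs_quadratic_form_le[of g H] unfolding defs(3,4)
    by (intro add_left_mono add_right_mono mult_left_mono) auto
  also have "\<dots> = f x - \<alpha> * n\<^sup>2 * (1 - \<alpha> * h / 2 - \<sigma> * n * \<alpha>\<^sup>2 / 6)"
    by (simp add: power2_eq_square power3_eq_cube algebra_simps)
  also have "\<dots> < f x"
  proof -
    have "0 < 1 - \<alpha> * h / 2 - \<sigma> * n * \<alpha>\<^sup>2 / 6"
      using \<alpha>h \<alpha>\<sigma> \<open>\<beta> < 1\<close> by linarith
    then show ?thesis
      using \<open>0 < \<alpha>\<close> \<open>0 < n\<close> by simp
  qed
  finally show ?thesis .
qed

lemma quad_model_decrease:
  assumes "cubic_model f x I \<sigma> s < f x"
  shows "\<sigma> / 6 * norm s ^ 3 < f x - quad_model f x I s"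
  using assms by (simp add: cubic_model_def)

context lipschitz_hessian
begin

text \<open>
  \<open>1 - \<rho>\<close> is the error \<open>f(x + s) - q(s) \<le> L/6 * \<parallel>s\<parallel>\<^sup>3\<close> divided by the predicted decrease,
  which exceeds \<open>\<sigma>/6 * \<parallel>s\<parallel>\<^sup>3\<close>.
\<close>

lemma reduction_ratio_ge:
  assumes "0 < \<sigma>" "s \<in> block_space I" and decrease: "cubic_model f x I \<sigma> s < f x"
  shows "1 - L / \<sigma> \<le> reduction_ratio f x I s"
proof -
  let ?D = "f x - quad_model f x I s"
  have "\<sigma> / 6 * norm s ^ 3 < ?D"
    by (rule quad_model_decrease[OF decrease])
  moreover have "0 \<le> \<sigma> / 6 * norm s ^ 3"
    using \<open>0 < \<sigma>\<close> by simp
  ultimately have "0 < ?D"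
    by linarith
  have "f (x + s) - quad_model f x I s \<le> L / 6 * norm s ^ 3"
    using taylor[of x s] quad_model_on_block_space[OF \<open>s \<in> block_space I\<close>, of f x] by linarith
  also have "\<dots> = L / \<sigma> * (\<sigma> / 6 * norm s ^ 3)"
    using \<open>0 < \<sigma>\<close> by simp
  also have "\<dots> \<le> L / \<sigma> * ?D"
    using quad_model_decrease[OF decrease] \<open>0 < \<sigma>\<close> L_pos by (intro mult_left_mono) auto
  finally have "(1 - L / \<sigma>) * ?D \<le> f x - f (x + s)"
    by (simp add: algebra_simps)
  then show ?thesis
    using \<open>0 < ?D\<close> by (simp add: reduction_ratio_def quad_model_0 pos_le_divide_eq)
qed

lemma block_hessian_symmetric:
  "w \<bullet> (block_hessian f I x *v v) = v \<bullet> (block_hessian f I x *v w)"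
proof -
  have "w \<bullet> (block_hessian f I x *v v) = block_vec I w \<bullet> (hessian f x *v block_vec I v)" for v w
    by (simp add: block_hessian_def block_mat_vector_mult flip: inner_block_vec)
  then show ?thesis
    by (metis hessian_symmetric)
qed

lemma gradient_cubic_model:
  assumes "s \<noteq> 0"
  shows "gradient (cubic_model f x I \<sigma>) s
    = block_gradient f I x + block_hessian f I x *v s + (\<sigma> / 2 * norm s) *\<^sub>R s"
proof (rule gradient_eqI)
  let ?H = "block_hessian f I x"
  have cubic: "\<sigma> / 6 * (3 * (h \<bullet> sgn s) * norm s ^ 2) = \<sigma> / 2 * norm s * (h \<bullet> s)" for h
    using assms by (simp add: sgn_div_norm power2_eq_square)
  have mult: "((\<lambda>s. ?H *v s) has_derivative (\<lambda>h. ?H *v h)) (at s)"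
    by (rule bounded_linear_imp_has_derivative) (rule matrix_vector_mul_bounded_linear)
  show "GDERIV (cubic_model f x I \<sigma>) s
      :> block_gradient f I x + ?H *v s + (\<sigma> / 2 * norm s) *\<^sub>R s"
    unfolding gderiv_def cubic_model_def quad_model_def
    by (rule derivative_eq_intros has_derivative_norm mult refl assms)+
      (simp add: fun_eq_iff inner_simps block_hessian_symmetric[of s] inner_commute cubic[simplified])
qed

text \<open>
  On the block, \<open>\<nabla>f(x + s)\<close> is the model gradient plus the Taylor error of \<open>\<nabla>f\<close> minus the gradient
  of the cubic term. The three contribute \<open>\<tau>\<close>, \<open>L/2\<close> and \<open>\<sigma>/2\<close> to the factor of \<open>\<parallel>s\<parallel>\<^sup>2\<close>.
\<close>

lemma block_gradient_after_step_le:
  assumes "s \<noteq> 0" "s \<in> block_space I" "0 < \<sigma>"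
    and inexact: "norm (gradient (cubic_model f x I \<sigma>) s) \<le> \<tau> * (norm s)\<^sup>2"
  shows "norm (block_gradient f I (x + s)) \<le> (\<tau> + (\<sigma> + L) / 2) * (norm s)\<^sup>2"
proof -
  let ?m = "gradient (cubic_model f x I \<sigma>) s"
  let ?e = "block_vec I (gradient f (x + s) - gradient f x - hessian f x *v s)"
  have "block_gradient f I (x + s) = ?m + ?e - (\<sigma> / 2 * norm s) *\<^sub>R s"
    using assms by (simp add: gradient_cubic_model block_gradient_def block_hessian_def
        block_mat_vector_mult block_vec_of_block_space block_vec_diff)
  also have "norm \<dots> \<le> norm ?m + norm ?e + norm ((\<sigma> / 2 * norm s) *\<^sub>R s)"
    by (meson add_right_mono norm_triangle_ineq norm_triangle_ineq4 order_trans)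
  also have "\<dots> \<le> \<tau> * (norm s)\<^sup>2 + L / 2 * (norm s)\<^sup>2 + \<sigma> / 2 * (norm s)\<^sup>2"
    using inexact order_trans[OF norm_block_vec_le gradient_taylor, of I x s] \<open>0 < \<sigma>\<close>
    by (intro add_mono) (auto simp: power2_eq_square)
  finally show ?thesis
    by (simp add: algebra_simps add_divide_distrib)
qed

end

section \<open>Counting iterations\<close>

lemma card_mult_le_total_decrease:
  fixes a :: "nat \<Rightarrow> real"
  assumes "\<And>k. k < N \<Longrightarrow> a (Suc k) \<le> a k"
    and "\<And>k. k < N \<Longrightarrow> k \<in> A \<Longrightarrow> a (Suc k) + \<delta> \<le> a k"
  shows "real (card (A \<inter> {..<N})) * \<delta> \<le> a 0 - a N"
  using assms
proof (induction N)
  case (Suc N)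
  then have IH: "real (card (A \<inter> {..<N})) * \<delta> \<le> a 0 - a N"
    by simp
  show ?case
  proof (cases "N \<in> A")
    case True
    then show ?thesis
      using IH Suc.prems(2)[of N] by (simp add: lessThan_Suc algebra_simps)
  next
    case False
    then show ?thesis
      using IH Suc.prems(1)[of N] by (simp add: lessThan_Suc)
  qed
qed simp

text \<open>
  In logarithms, each step outside \<open>S\<close> raises \<open>\<sigma>\<close> by at least \<open>ln \<gamma>2\<close> and each step in \<open>S\<close> lowers
  it by at most \<open>\<bar>ln \<gamma>1\<bar>\<close>. The net rise is at most \<open>ln (\<sigma>max / \<sigma> 0)\<close>, so a step in \<open>S\<close> can pay
  for at most \<open>\<bar>ln \<gamma>1\<bar> / ln \<gamma>2\<close> steps outside.
\<close>

lemma iterations_le_of_growth: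
  fixes \<sigma> :: "nat \<Rightarrow> real"
  assumes "0 < \<sigma> 0" "0 < \<gamma>1" "1 < \<gamma>2"
    and inside: "\<And>k. k < N \<Longrightarrow> k \<in> S \<Longrightarrow> \<gamma>1 * \<sigma> k \<le> \<sigma> (Suc k)"
    and outside: "\<And>k. k < N \<Longrightarrow> k \<notin> S \<Longrightarrow> \<gamma>2 * \<sigma> k \<le> \<sigma> (Suc k)"
    and bounded: "\<sigma> N \<le> \<sigma>max"
  shows "real N \<le> (1 + \<bar>ln \<gamma>1\<bar> / ln \<gamma>2) * real (card (S \<inter> {..<N})) + 1 / ln \<gamma>2 * ln (\<sigma>max / \<sigma> 0)"
proof -
  let ?c = "\<lambda>n. real (card (S \<inter> {..<n}))"
  have growth: "0 < \<sigma> n \<and> ln (\<sigma> 0) + (real n - ?c n) * ln \<gamma>2 - ?c n * \<bar>ln \<gamma>1\<bar> \<le> ln (\<sigma> n)"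
    if "n \<le> N" for n
    using that
  proof (induction n)
    case 0
    then show ?case
      using \<open>0 < \<sigma> 0\<close> by simp
  next
    case (Suc n)
    then have "n < N" "0 < \<sigma> n"
      and IH: "ln (\<sigma> 0) + (real n - ?c n) * ln \<gamma>2 - ?c n * \<bar>ln \<gamma>1\<bar> \<le> ln (\<sigma> n)"
      by auto
    have ln_growth: "0 < \<sigma> (Suc n) \<and> ln \<gamma> + ln (\<sigma> n) \<le> ln (\<sigma> (Suc n))"
      if "0 < \<gamma>" "\<gamma> * \<sigma> n \<le> \<sigma> (Suc n)" for \<gamma>
    proof -
      have "0 < \<gamma> * \<sigma> n"
        using that \<open>0 < \<sigma> n\<close> by simp
      moreover have "ln \<gamma> + ln (\<sigma> n) = ln (\<gamma> * \<sigma> n)"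
        using that \<open>0 < \<sigma> n\<close> by (simp add: ln_mult)
      ultimately show ?thesis
        using that by (simp add: ln_mono)
    qed
    show ?case
    proof (cases "n \<in> S")
      case True
      then show ?thesis
        using ln_growth[of \<gamma>1] inside[OF \<open>n < N\<close>] \<open>0 < \<gamma>1\<close> IH
          abs_ge_minus_self[of "ln \<gamma>1"]
        by (simp add: lessThan_Suc algebra_simps)
    next
      case False
      then show ?thesis
        using ln_growth[of \<gamma>2] outside[OF \<open>n < N\<close>] \<open>1 < \<gamma>2\<close> IH
        by (simp add: lessThan_Suc algebra_simps)
    qed
  qed
  have "0 < \<sigma> N" and N: "ln (\<sigma> 0) + (real N - ?c N) * ln \<gamma>2 - ?c N * \<bar>ln \<gamma>1\<bar> \<le> ln (\<sigma> N)"
    using growth by auto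
  moreover have "ln (\<sigma> N) \<le> ln \<sigma>max"
    using bounded \<open>0 < \<sigma> N\<close> by (intro ln_mono) auto
  moreover have "ln (\<sigma>max / \<sigma> 0) = ln \<sigma>max - ln (\<sigma> 0)"
    using bounded \<open>0 < \<sigma> N\<close> \<open>0 < \<sigma> 0\<close> by (simp add: ln_div)
  ultimately have "real N * ln \<gamma>2 \<le> ?c N * ln \<gamma>2 + ?c N * \<bar>ln \<gamma>1\<bar> + ln (\<sigma>max / \<sigma> 0)"
    by (simp add: algebra_simps)
  moreover have "0 < ln \<gamma>2"
    using \<open>1 < \<gamma>2\<close> by simp
  ultimately show ?thesis
    by (simp add: field_simps)
qed

section \<open>Runs of the method\<close>

locale ibcn = lipschitz_hessian f L
  for f :: "real ^ 'n \<Rightarrow> real" and L +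
  fixes x s :: "nat \<Rightarrow> real ^ 'n" and I :: "nat \<Rightarrow> 'n set" and \<sigma> :: "nat \<Rightarrow> real"
    and \<sigma>min \<eta>1 \<eta>2 \<gamma>1 \<gamma>2 \<gamma>3 \<tau> \<beta> \<theta> :: real
  assumes sigma_min: "0 < \<sigma>min" "\<sigma>min \<le> \<sigma> 0"
    and eta: "0 < \<eta>1" "\<eta>1 \<le> \<eta>2" "\<eta>2 < 1"
    and gamma: "0 < \<gamma>1" "\<gamma>1 \<le> 1" "1 < \<gamma>2" "\<gamma>2 \<le> \<gamma>3"
    and tau: "0 \<le> \<tau>"
    and beta: "0 < \<beta>" "\<beta> < 1"
    and theta: "0 < \<theta>"
    and run: "ibcn_run f \<sigma>min \<eta>1 \<eta>2 \<gamma>1 \<gamma>2 \<gamma>3 \<tau> \<beta> \<theta> x I s \<sigma>"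
begin

abbreviation \<rho> :: "nat \<Rightarrow> real" where
  "\<rho> k \<equiv> reduction_ratio f (x k) (I k) (s k)"

definition \<sigma>max :: real where
  "\<sigma>max = max (\<sigma> 0) (\<gamma>3 * L / (1 - \<eta>2))"

lemma iteration:
  assumes "performed f x k"
  shows "\<theta> * norm (gradient f (x k)) \<le> norm (block_gradient f (I k) (x k))"
    and "s k \<in> block_space (I k)"
    and "norm (gradient (cubic_model f (x k) (I k) (\<sigma> k)) (s k)) \<le> \<tau> * (norm (s k))\<^sup>2"
    and "cubic_model f (x k) (I k) (\<sigma> k) (s k)
      \<le> cubic_model f (x k) (I k) (\<sigma> k) (cauchy_step f \<beta> (x k) (I k) (\<sigma> k))"
    and "x (Suc k) = (if \<eta>1 \<le> \<rho> k then x k + s k else x k)"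
    and "\<eta>2 \<le> \<rho> k \<Longrightarrow> max \<sigma>min (\<gamma>1 * \<sigma> k) \<le> \<sigma> (Suc k) \<and> \<sigma> (Suc k) \<le> \<sigma> k"
    and "\<rho> k < \<eta>2 \<Longrightarrow> \<eta>1 \<le> \<rho> k \<Longrightarrow> \<sigma> k \<le> \<sigma> (Suc k) \<and> \<sigma> (Suc k) \<le> \<gamma>2 * \<sigma> k"
    and "\<rho> k < \<eta>1 \<Longrightarrow> \<gamma>2 * \<sigma> k \<le> \<sigma> (Suc k) \<and> \<sigma> (Suc k) \<le> \<gamma>3 * \<sigma> k"
  using run[unfolded ibcn_run_def, rule_format, OF assms] eta
  by (auto simp: ibcn_iteration_def Let_def split: if_splits)

lemma cubic_model_less:
  assumes "performed f x k" "0 < \<sigma> k"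
  shows "cubic_model f (x k) (I k) (\<sigma> k) (s k) < f (x k)"
proof -
  have "gradient f (x k) \<noteq> 0"
    using \<open>performed f x k\<close> by (simp add: performed_def)
  then have "0 < \<theta> * norm (gradient f (x k))"
    using theta by simp
  then have "block_gradient f (I k) (x k) \<noteq> 0"
    using iteration(1)[OF \<open>performed f x k\<close>] by auto
  then show ?thesis
    using cubic_model_cauchy_step_less \<open>0 < \<sigma> k\<close> beta iteration(4)[OF \<open>performed f x k\<close>]
    by (meson le_less_trans)
qed

text \<open>
  \<open>\<sigma>\<close> increases only if \<open>\<rho> < \<eta>2\<close>. By \<open>\<rho> \<ge> 1 - L/\<sigma>\<close> this means \<open>\<sigma> < L/(1 - \<eta>2)\<close>, and one increase is
  by a factor of at most \<open>\<gamma>3\<close>. The two bounds are proved together because the estimate of \<open>\<rho>\<close>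
  relies on the positivity of \<open>\<sigma>\<close>.
\<close>

lemma regularization_bounds:
  assumes "\<forall>j<k. performed f x j"
  shows "\<sigma>min \<le> \<sigma> k \<and> \<sigma> k \<le> \<sigma>max"
  using assms
proof (induction k)
  case 0
  then show ?case
    using sigma_min by (simp add: \<sigma>max_def)
next
  case (Suc k)
  then have performed: "performed f x k" and IH: "\<sigma>min \<le> \<sigma> k" "\<sigma> k \<le> \<sigma>max"
    by auto
  then have "0 < \<sigma> k"
    using sigma_min by linarith
  have growth: "\<sigma> k \<le> \<gamma>2 * \<sigma> k" "\<gamma>2 * \<sigma> k \<le> \<gamma>3 * \<sigma> k"
    using gamma \<open>0 < \<sigma> k\<close> by auto
  show ?case
  proof (cases "\<eta>2 \<le> \<rho> k")
    case True
    then show ?thesis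
      using iteration(6)[OF performed] IH by auto
  next
    case False
    then have "1 - L / \<sigma> k < \<eta>2"
      using reduction_ratio_ge[OF \<open>0 < \<sigma> k\<close> iteration(2)[OF performed]
          cubic_model_less[OF performed \<open>0 < \<sigma> k\<close>]] by linarith
    then have "\<sigma> k \<le> L / (1 - \<eta>2)"
      using \<open>0 < \<sigma> k\<close> eta by (simp add: field_simps)
    then have "\<gamma>3 * \<sigma> k \<le> \<gamma>3 * (L / (1 - \<eta>2))"
      using gamma by (intro mult_left_mono) auto
    then have "\<gamma>3 * \<sigma> k \<le> \<sigma>max"
      by (simp add: \<sigma>max_def)
    moreover have "\<sigma> k \<le> \<sigma> (Suc k) \<and> \<sigma> (Suc k) \<le> \<gamma>3 * \<sigma> k"
      using iteration(7,8)[OF performed] False growth by force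
    ultimately show ?thesis
      using IH by linarith
  qed
qed

lemma performed_before: "performed f x k \<Longrightarrow> j \<le> k \<Longrightarrow> performed f x j"
  by (simp add: performed_def)

lemma regularization_bounds_performed:
  assumes "performed f x k"
  shows "\<sigma>min \<le> \<sigma> k" "\<sigma> k \<le> \<sigma>max" "0 < \<sigma> k"
  using regularization_bounds[of k] performed_before[OF assms] sigma_min by force+

text \<open>
  By success, \<open>f\<close> achieves at least the fraction \<open>\<eta>1\<close> of the decrease of the quadratic model, which
  exceeds \<open>\<sigma>/6 * \<parallel>s\<parallel>\<^sup>3\<close>.
\<close>

lemma successful_decrease:
  assumes "k \<in> successful f \<eta>1 x I s"
  shows "\<eta>1 * \<sigma>min / 6 * norm (s k) ^ 3 \<le> f (x k) - f (x (Suc k))"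
proof -
  have performed: "performed f x k" and "\<eta>1 \<le> \<rho> k"
    using assms by (auto simp: successful_def)
  note bounds = regularization_bounds_performed[OF performed]
  let ?D = "f (x k) - quad_model f (x k) (I k) (s k)"
  have D: "\<sigma> k / 6 * norm (s k) ^ 3 < ?D"
    by (rule quad_model_decrease[OF cubic_model_less[OF performed bounds(3)]])
  moreover have "0 \<le> \<sigma> k / 6 * norm (s k) ^ 3"
    using bounds(3) by simp
  ultimately have "0 < ?D"
    by linarith
  have "\<eta>1 * \<sigma>min / 6 * norm (s k) ^ 3 = \<eta>1 * (\<sigma>min / 6 * norm (s k) ^ 3)"
    by simp
  also have "\<dots> \<le> \<eta>1 * (\<sigma> k / 6 * norm (s k) ^ 3)"
    using eta bounds(1) by (intro mult_left_mono mult_right_mono divide_right_mono) auto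
  also have "\<dots> \<le> \<eta>1 * ?D"
    using eta D by (intro mult_left_mono) auto
  also have "\<dots> \<le> f (x k) - f (x k + s k)"
    using \<open>\<eta>1 \<le> \<rho> k\<close> \<open>0 < ?D\<close>
    by (simp add: reduction_ratio_def quad_model_0 pos_le_divide_eq)
  finally show ?thesis
    using iteration(5)[OF performed] \<open>\<eta>1 \<le> \<rho> k\<close> by simp
qed

lemma nonincreasing:
  assumes "performed f x k"
  shows "f (x (Suc k)) \<le> f (x k)"
proof (cases "\<eta>1 \<le> \<rho> k")
  case True
  then have "\<eta>1 * \<sigma>min / 6 * norm (s k) ^ 3 \<le> f (x k) - f (x (Suc k))"
    using assms by (intro successful_decrease) (simp add: successful_def)
  moreover have "0 \<le> \<eta>1 * \<sigma>min / 6 * norm (s k) ^ 3"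
    using eta sigma_min by simp
  ultimately show ?thesis
    by linarith
next
  case False
  then show ?thesis
    using iteration(5)[OF assms] by simp
qed

text \<open>
  The bound on the block gradient after the step reads backwards as a lower bound on the length
  of the step: \<open>\<parallel>s\<parallel>\<^sup>2 \<ge> \<epsilon> / (\<tau> + (\<sigma>max + L) / 2)\<close>. Raised to the power \<open>3/2\<close> it meets the
  cubic decrease of a successful iteration.
\<close>

lemma large_gradient_decrease:
  assumes "0 < \<epsilon>" "k \<in> large_block_gradient f x I \<epsilon>" "k \<in> successful f \<eta>1 x I s"
  shows "\<eta>1 * \<sigma>min / 6 * (\<epsilon> / (\<tau> + (\<sigma>max + L) / 2)) powr (3 / 2) \<le> f (x k) - f (x (Suc k))"
proof -
  let ?M = "\<tau> + (\<sigma>max + L) / 2"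
  have performed: "performed f x k" and "\<eta>1 \<le> \<rho> k"
    using assms by (auto simp: successful_def)
  note bounds = regularization_bounds_performed[OF performed]
  have "0 < ?M"
    using tau bounds L_pos by argo
  have "s k \<noteq> 0"
    using cubic_model_less[OF performed bounds(3)] by (auto simp: cubic_model_def quad_model_0)
  have "\<epsilon> \<le> norm (block_gradient f (I k) (x k + s k))"
    using assms(2) iteration(5)[OF performed] \<open>\<eta>1 \<le> \<rho> k\<close> by (simp add: large_block_gradient_def)
  also have "\<dots> \<le> (\<tau> + (\<sigma> k + L) / 2) * (norm (s k))\<^sup>2"
    by (rule block_gradient_after_step_le[OF \<open>s k \<noteq> 0\<close> iteration(2)[OF performed] bounds(3)
          iteration(3)[OF performed]])
  also have "\<dots> \<le> ?M * (norm (s k))\<^sup>2"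
    using bounds(2) by (intro mult_right_mono) auto
  finally have "\<epsilon> / ?M \<le> (norm (s k))\<^sup>2"
    using \<open>0 < ?M\<close> by (simp add: pos_divide_le_eq mult.commute)
  then have "(\<epsilon> / ?M) powr (3 / 2) \<le> ((norm (s k))\<^sup>2) powr (3 / 2)"
    using \<open>0 < \<epsilon>\<close> \<open>0 < ?M\<close> by (intro powr_mono2) auto
  also have "\<dots> = (norm (s k) powr 2) powr (3 / 2)"
    using \<open>s k \<noteq> 0\<close> by simp
  also have "\<dots> = norm (s k) ^ 3"
    using \<open>s k \<noteq> 0\<close> by (simp only: powr_powr) simp
  finally have "\<eta>1 * \<sigma>min / 6 * (\<epsilon> / ?M) powr (3 / 2) \<le> \<eta>1 * \<sigma>min / 6 * norm (s k) ^ 3"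
    using eta sigma_min by (intro mult_left_mono) auto
  then show ?thesis
    using successful_decrease[OF assms(3)] by linarith
qed

lemma card_le:
  assumes "0 < \<epsilon>" and performed: "\<forall>j<N. performed f x j"
    and bounded_below: "\<And>y. f y \<le> f (x 0) \<Longrightarrow> fmin \<le> f y"
  shows "real (card (large_block_gradient f x I \<epsilon> \<inter> successful f \<eta>1 x I s \<inter> {..<N}))
      * (\<eta>1 * \<sigma>min / 6 * (\<epsilon> / (\<tau> + (\<sigma>max + L) / 2)) powr (3 / 2)) \<le> f (x 0) - fmin"
    (is "real (card (?A \<inter> _)) * ?\<delta> \<le> _")
proof -
  have "f (x N) \<le> f (x 0)"
    using performed
    by (induction N) (auto intro: order_trans[OF nonincreasing])
  moreover have "real (card (?A \<inter> {..<N})) * ?\<delta> \<le> f (x 0) - f (x N)"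
    using performed nonincreasing large_gradient_decrease[OF \<open>0 < \<epsilon>\<close>]
    by (intro card_mult_le_total_decrease[where a="\<lambda>k. f (x k)"]) (auto simp: le_diff_eq add.commute)
  ultimately show ?thesis
    using bounded_below[of "x N"] by linarith
qed

lemma iterations_le:
  assumes "\<forall>j<N. performed f x j"
  shows "real N \<le> (1 + \<bar>ln \<gamma>1\<bar> / ln \<gamma>2) * real (card (successful f \<eta>1 x I s \<inter> {..<N}))
    + 1 / ln \<gamma>2 * ln (\<sigma>max / \<sigma> 0)"
proof (rule iterations_le_of_growth)
  show "\<sigma> N \<le> \<sigma>max"
    using regularization_bounds[OF assms] ..
  show "0 < \<sigma> 0" "0 < \<gamma>1" "1 < \<gamma>2"
    using sigma_min gamma by auto
  fix k assume "k < N"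
  then have performed: "performed f x k"
    using assms by simp
  have "\<gamma>1 * \<sigma> k \<le> \<sigma> k"
    using gamma regularization_bounds_performed(3)[OF performed] by simp
  then show "\<gamma>1 * \<sigma> k \<le> \<sigma> (Suc k)" if "k \<in> successful f \<eta>1 x I s"
    using that iteration(6,7)[OF performed] by (force simp: successful_def)
  show "\<gamma>2 * \<sigma> k \<le> \<sigma> (Suc k)" if "k \<notin> successful f \<eta>1 x I s"
    using that performed iteration(8)[OF performed] by (simp add: successful_def)
qed

text \<open>
  Bounds on all initial segments of a run, whether or not the method stops, bound the whole set: a
  finite set of performed iterations lies below the successor of its largest element, and all
  iterations up to that element are performed.
\<close>

lemma finite_card_le:
  fixes P :: real
  assumes "A \<subseteq> {k. performed f x k}"
    and "\<And>N. \<forall>j<N. performed f x j \<Longrightarrow> real (card (A \<inter> {..<N})) \<le> P"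
  shows "finite A \<and> real (card A) \<le> P"
proof -
  have "card G \<le> nat \<lfloor>P\<rfloor>" if "G \<subseteq> A" "finite G" for G
  proof (cases "G = {}")
    case False
    define N where "N = Suc (Max G)"
    have "performed f x (Max G)"
      using that False assms(1) Max_in by blast
    then have "\<forall>j<N. performed f x j"
      using performed_before by (simp add: N_def less_Suc_eq_le)
    then have "real (card (A \<inter> {..<N})) \<le> P"
      by (rule assms(2))
    moreover have "G \<subseteq> A \<inter> {..<N}"
      using that by (auto simp: N_def less_Suc_eq_le)
    then have "card G \<le> card (A \<inter> {..<N})"
      by (intro card_mono) auto
    ultimately show ?thesis
      by linarith
  qed simp
  then have "finite A" "card A \<le> nat \<lfloor>P\<rfloor>"
    using finite_if_finite_subsets_card_bdd[of A "nat \<lfloor>P\<rfloor>"] by auto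
  moreover have "0 \<le> P"
    using assms(2)[of 0] by simp
  ultimately show ?thesis
    by linarith
qed

end

theorem theorem13:
  fixes f :: "real ^ 'n \<Rightarrow> real"
    and x s :: "nat \<Rightarrow> real ^ 'n" and I :: "nat \<Rightarrow> 'n set" and \<sigma> :: "nat \<Rightarrow> real"
    and L \<sigma>min \<eta>1 \<eta>2 \<gamma>1 \<gamma>2 \<gamma>3 \<tau> \<beta> \<theta> fmin B \<epsilon> \<sigma>max c2 :: real
  assumes "\<And>y. f differentiable (at y)"
    and "\<And>y. gradient f differentiable (at y)"
    and "L > 0"
    and "\<And>y z. op_norm (hessian f y - hessian f z) \<le> L * norm (y - z)"
    and "\<sigma>min > 0" and "\<sigma> 0 \<ge> \<sigma>min"
    and "0 < \<eta>1" and "\<eta>1 \<le> \<eta>2" and "\<eta>2 < 1"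
    and "0 < \<gamma>1" and "\<gamma>1 \<le> 1" and "1 < \<gamma>2" and "\<gamma>2 \<le> \<gamma>3"
    and "0 \<le> \<tau>" and "0 < \<beta>" and "\<beta> < 1" and "0 < \<theta>" and "\<theta> \<le> 1"
    and "ibcn_run f \<sigma>min \<eta>1 \<eta>2 \<gamma>1 \<gamma>2 \<gamma>3 \<tau> \<beta> \<theta> x I s \<sigma>"
    and "\<And>y. f y \<le> f (x 0) \<Longrightarrow> f y \<ge> fmin"
    and "\<And>y. f y \<le> f (x 0) \<Longrightarrow> op_norm (hessian f y) \<le> B"
    and "\<epsilon> > 0"
    and "\<sigma>max = max (\<sigma> 0) (\<gamma>3 * L / (1 - \<eta>2))"
    and "c2 = \<eta>1 * \<sigma>min / 6 * (\<tau> + (\<sigma>max + L) / 2) powr (- 3 / 2)"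
  shows "finite (large_block_gradient f x I \<epsilon> \<inter> successful f \<eta>1 x I s) \<and>
    real (card (large_block_gradient f x I \<epsilon> \<inter> successful f \<eta>1 x I s))
      \<le> (f (x 0) - fmin) / c2 * \<epsilon> powr (- 3 / 2) \<and>
    (\<exists>k. k \<notin> large_block_gradient f x I \<epsilon>) \<and>
    real (LEAST k. k \<notin> large_block_gradient f x I \<epsilon>)
      \<le> (1 + \<bar>ln \<gamma>1\<bar> / ln \<gamma>2) * ((f (x 0) - fmin) / c2) * \<epsilon> powr (- 3 / 2)
        + 1 / ln \<gamma>2 * ln (\<sigma>max / \<sigma> 0)"
proof -
  interpret run: ibcn f L x s I \<sigma> \<sigma>min \<eta>1 \<eta>2 \<gamma>1 \<gamma>2 \<gamma>3 \<tau> \<beta> \<theta>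
    using assms(1-19) by unfold_locales auto
  have \<sigma>max: "run.\<sigma>max = \<sigma>max"
    unfolding run.\<sigma>max_def assms(23) ..
  let ?K = "large_block_gradient f x I \<epsilon>" and ?S = "successful f \<eta>1 x I s"
  let ?M = "\<tau> + (\<sigma>max + L) / 2"
  let ?P = "(f (x 0) - fmin) / c2 * \<epsilon> powr (- 3 / 2)"
  have "\<sigma> 0 \<le> \<sigma>max"
    unfolding assms(23) by simp
  then have "0 < ?M"
    using assms(3,5,6,14) by argo
  then have "0 < c2"
    unfolding assms(24) using assms(5,7) by simp
  have \<delta>: "\<eta>1 * \<sigma>min / 6 * (\<epsilon> / ?M) powr (3 / 2) = c2 * \<epsilon> powr (3 / 2)"
    using \<open>0 < ?M\<close> \<open>\<epsilon> > 0\<close> unfolding assms(24)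
    by (simp add: powr_divide powr_minus_divide)
  have count: "real (card (?K \<inter> ?S \<inter> {..<N})) \<le> ?P" if "\<forall>j<N. performed f x j" for N
  proof -
    have "real (card (?K \<inter> ?S \<inter> {..<N})) * (c2 * \<epsilon> powr (3 / 2)) \<le> f (x 0) - fmin"
      using run.card_le[OF \<open>\<epsilon> > 0\<close> that assms(20)] unfolding \<sigma>max \<delta> .
    then show ?thesis
      using \<open>0 < c2\<close> \<open>\<epsilon> > 0\<close> by (simp add: powr_minus_divide field_simps)
  qed
  have card: "finite (?K \<inter> ?S) \<and> real (card (?K \<inter> ?S)) \<le> ?P"
    by (rule run.finite_card_le[OF _ count]) (auto simp: successful_def)
  let ?C = "1 + \<bar>ln \<gamma>1\<bar> / ln \<gamma>2" and ?R = "1 / ln \<gamma>2 * ln (\<sigma>max / \<sigma> 0)"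
  have prefix: "real N \<le> ?C * ?P + ?R" if "{..<N} \<subseteq> ?K" for N
  proof -
    have performed: "\<forall>j<N. performed f x j"
      using that by (auto simp: large_block_gradient_def)
    have "?S \<inter> {..<N} = ?K \<inter> ?S \<inter> {..<N}"
      using that by auto
    then have "real (card (?S \<inter> {..<N})) \<le> ?P"
      using count[OF performed] by simp
    moreover have "0 \<le> ?C"
      using assms(12) by simp
    ultimately have "?C * real (card (?S \<inter> {..<N})) \<le> ?C * ?P"
      by (rule mult_left_mono)
    then show ?thesis
      using run.iterations_le[OF performed] unfolding \<sigma>max by linarith
  qed
  \<comment> \<open>The bound on initial segments also shows that the set misses some index.\<close>
  obtain N :: nat where "?C * ?P + ?R < real N"
    using reals_Archimedean2 by blast
  then have outside: "\<exists>k. k \<notin> ?K"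
    using prefix[of N] by (auto simp: not_le[symmetric])
  have "{..<LEAST k. k \<notin> ?K} \<subseteq> ?K"
    using not_less_Least by blast
  then have "real (LEAST k. k \<notin> ?K) \<le> ?C * ?P + ?R"
    by (rule prefix)
  then show ?thesis
    using card outside by (simp only: mult.assoc simp_thms)
qed

end
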